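(* Let $f:\mathbb{R}^n\to\mathbb{R}\cup\{+\infty\}$ be a proper convex function with closed epigraph, continuously differentiable in $\operatorname{int}(\operatorname{dom}(f))$, such that $0\in\operatorname{int}(\operatorname{dom}(f))$ is the unique minimizer of $f$, $\nabla f(0)=0$ and $f(0)=0$. Let $K=\operatorname{epi}(f)\subset\mathbb{R}^{n+1}$ and $U=\{(x,0)\mid x\in\mathbb{R}^n\}\subset\mathbb{R}^{n+1}$. Then the sequence generated by MAP for the pair $K,U$ from an arbitrary initial point converges sublinearly. If $f$ also satisfies $$\gamma:=\liminf_{x\to0}\frac{f(x)}{\|x\|\,\|\nabla f(x)\|}>0,$$ then the sequence generated by CRM for the pair $K,U$ from an initial point in $U$ converges linearly, and its asymptotic constant is bounded above by $\sqrt{1-\gamma^2}<1$.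
   Context: $\operatorname{dom}(f)=\{x\in\mathbb{R}^n\mid f(x)<+\infty\}$, $\operatorname{int}$ denotes the topological interior, and $\operatorname{epi}(f)$ is the epigraph of $f$ in $\mathbb{R}^{n+1}=\mathbb{R}^n\times\mathbb{R}$. $P_K,P_U$ are the orthogonal projections onto $K,U$; $R_K=2P_K-\mathrm{Id}$ and $R_U=2P_U-\mathrm{Id}$ are the reflections. The Method of Alternating Projections (MAP) iterates the operator $T=P_U\circ P_K$. The Circumcentered-Reflection Method (CRM) iterates the operator $C(w)=\operatorname{circ}(w,R_K(w),R_U(R_K(w)))$, where $\operatorname{circ}(a,b,c)$ is the point of the affine hull of $\{a,b,c\}$ equidistant from $a,b,c$; it is known that $C(w)$ is well defined and belongs to $U$ for every $w\in U$ when $K\cap U\neq\emptyset$. Here $K\cap U=\{(0,0)\}$, and it is known that both MAP (from any point of $\mathbb{R}^{n+1}$) and CRM (from any point of $U$) converge to $(0,0)$. Convergence rates are understood in the Q-sense, defined as follows. Let $(y^k)_{k\in\mathbb{N}}$ converge to $y^*$, and assume that $y^k\ne y^*$ for all $k$. Put $q=\limsup_{k\to\infty}\|y^{k+1}-y^*\|/\|y^k-y^*\|$. The convergence is superlinear if $q=0$, linear if $q\in(0,1)$, and sublinear if $q\ge1$; the value $q$ is called the asymptotic constant of the sequence.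
   Formalization: "CRM converges linearly" is read as linearly or superlinearly, since an asymptotic constant of 0 can occur (e.g. f(x) = |x|/(-ln|x|) near 0, where γ = 1); initial points whose sequence reaches (0,0) have no rate and are excluded. *)

theory Defs
  imports "HOL-Analysis.Analysis"
begin

definition eff_dom :: "('a \<Rightarrow> ereal) \<Rightarrow> 'a set" where
  "eff_dom f = {x. f x < \<infinity>}"

definition proper_ereal :: "('a \<Rightarrow> ereal) \<Rightarrow> bool" where
  "proper_ereal f \<longleftrightarrow> (\<forall>x. f x \<noteq> -\<infinity>) \<and> eff_dom f \<noteq> {}"

text \<open>The open range of \<^term>\<open>t\<close> avoids the products of \<^term>\<open>0\<close> and \<^term>\<open>\<infinity>\<close>.\<close>
definition convex_ereal :: "('a::real_vector \<Rightarrow> ereal) \<Rightarrow> bool" where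
  "convex_ereal f \<longleftrightarrow>
     (\<forall>x y. \<forall>t::real. 0 < t \<and> t < 1 \<longrightarrow>
        f ((1 - t) *\<^sub>R x + t *\<^sub>R y) \<le> ereal (1 - t) * f x + ereal t * f y)"

definition epi :: "('a \<Rightarrow> ereal) \<Rightarrow> ('a \<times> real) set" where
  "epi f = {(x, t). f x \<le> ereal t}"

text \<open>\<^term>\<open>g\<close> is the gradient of \<^term>\<open>f\<close> on the interior of its domain and is
  continuous there; its values elsewhere are unconstrained.\<close>
definition C1_with_gradient ::
    "('a::euclidean_space \<Rightarrow> ereal) \<Rightarrow> ('a \<Rightarrow> 'a) \<Rightarrow> bool" where
  "C1_with_gradient f g \<longleftrightarrow>
     (\<forall>x\<in>interior (eff_dom f). GDERIV (\<lambda>y. real_of_ereal (f y)) x :> g x) \<and>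
     continuous_on (interior (eff_dom f)) g"

definition reflection :: "'a::euclidean_space set \<Rightarrow> 'a \<Rightarrow> 'a" where
  "reflection S w = 2 *\<^sub>R closest_point S w - w"

definition circ :: "'a::euclidean_space \<Rightarrow> 'a \<Rightarrow> 'a \<Rightarrow> 'a" where
  "circ a b c = (THE p. p \<in> affine hull {a, b, c} \<and> dist p a = dist p b \<and> dist p a = dist p c)"

definition MAP_op :: "'a::euclidean_space set \<Rightarrow> 'a set \<Rightarrow> 'a \<Rightarrow> 'a" where
  "MAP_op K U = closest_point U \<circ> closest_point K"

definition CRM_op :: "'a::euclidean_space set \<Rightarrow> 'a set \<Rightarrow> 'a \<Rightarrow> 'a" where
  "CRM_op K U w = circ w (reflection K w) (reflection U (reflection K w))"

definition asymptotic_constant :: "(nat \<Rightarrow> 'a::real_normed_vector) \<Rightarrow> 'a \<Rightarrow> ereal" where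
  "asymptotic_constant y l = limsup (\<lambda>k. ereal (norm (y (Suc k) - l) / norm (y k - l)))"

text \<open>Rates are defined only for convergent sequences that never attain their limit.\<close>
definition has_Q_rate :: "(nat \<Rightarrow> 'a::real_normed_vector) \<Rightarrow> 'a \<Rightarrow> bool" where
  "has_Q_rate y l \<longleftrightarrow> y \<longlonglongrightarrow> l \<and> (\<forall>k. y k \<noteq> l)"

definition Q_superlinear :: "(nat \<Rightarrow> 'a::real_normed_vector) \<Rightarrow> 'a \<Rightarrow> bool" where
  "Q_superlinear y l \<longleftrightarrow> has_Q_rate y l \<and> asymptotic_constant y l = 0"

definition Q_linear :: "(nat \<Rightarrow> 'a::real_normed_vector) \<Rightarrow> 'a \<Rightarrow> bool" where
  "Q_linear y l \<longleftrightarrow> has_Q_rate y l \<and> 0 < asymptotic_constant y l \<and> asymptotic_constant y l < 1"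

definition Q_sublinear :: "(nat \<Rightarrow> 'a::real_normed_vector) \<Rightarrow> 'a \<Rightarrow> bool" where
  "Q_sublinear y l \<longleftrightarrow> has_Q_rate y l \<and> 1 \<le> asymptotic_constant y l"

end

theory Submission
  imports Defs
begin

text \<open>Both methods act on points \<open>(x, 0)\<close> of \<open>U\<close>. Let \<open>(y, h)\<close> be the projection of \<open>(x, 0)\<close>
  onto the epigraph. Then \<open>h = f y\<close>, and \<open>(x - y, -h)\<close> is normal to the epigraph at \<open>(y, h)\<close>;
  where \<open>f\<close> is differentiable this says \<open>x - y = f y *\<^sub>R g y\<close>, where \<open>g\<close> is the gradient.

  MAP sends \<open>x\<close> to \<open>y\<close>. Since \<open>f y \<le> norm y * norm (g y)\<close> by convexity,
  \<open>norm x \<le> norm y * (1 + (norm (g y))\<^sup>2)\<close>. As the iterates tend to \<open>0\<close>, where the gradient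
  vanishes, the quotients \<open>norm y / norm x\<close> are eventually bounded below by numbers tending to \<open>1\<close>.

  CRM sends \<open>x\<close> to the intersection of \<open>U\<close>, the supporting hyperplane of the epigraph at
  \<open>(y, h)\<close> and the line through \<open>x\<close> and \<open>y\<close>, that is, to
  \<open>y - (h\<^sup>2 / (norm (x - y))\<^sup>2) *\<^sub>R (x - y)\<close>. Near the origin this is the subgradient step
  \<open>y - (f y / (norm (g y))\<^sup>2) *\<^sub>R g y\<close>, whose squared norm is at most
  \<open>1 - (f y / (norm y * norm (g y)))\<^sup>2\<close> times that of \<open>y\<close>. The lower limit of the quotient
  occurring here is \<open>\<gamma>\<close>, and \<open>norm y \<le> norm x\<close>, so the bound on the asymptotic constant
  follows.

  Convergence to the origin is common to both: each step decreases the squared norm by at least the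
  squared distance to the epigraph, so that this distance tends to \<open>0\<close>, and only the origin of
  \<open>U\<close> lies in the epigraph. The iterates never reach the origin because the only normals to the
  epigraph there are vertical, the gradient at \<open>0\<close> being zero.\<close>

section \<open>Projecting onto the epigraph\<close>

lemma convex_epi:
  assumes "convex_ereal f"
  shows "convex (epi f)"
proof (rule convexI)
  fix p q :: "'a \<times> real" and u v :: real
  assume p: "p \<in> epi f" and q: "q \<in> epi f" and uv: "0 \<le> u" "0 \<le> v" "u + v = 1"
  obtain x a y b where pq: "p = (x, a)" "q = (y, b)" by (cases p, cases q)
  show "u *\<^sub>R p + v *\<^sub>R q \<in> epi f"
  proof (cases "u = 0 \<or> v = 0")
    case True
    then show ?thesis using uv p q by auto
  next
    case False
    then have v: "0 < v" "v < 1" and u: "u = 1 - v" using uv by auto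
    have "f ((1 - v) *\<^sub>R x + v *\<^sub>R y) \<le> ereal (1 - v) * f x + ereal v * f y"
      using assms v unfolding convex_ereal_def by blast
    also have "\<dots> \<le> ereal (1 - v) * ereal a + ereal v * ereal b"
      using p q pq v by (intro add_mono ereal_mult_left_mono) (auto simp: epi_def)
    finally show ?thesis using pq u by (simp add: epi_def)
  qed
qed

locale epigraph_minimum =
  fixes f :: "'a::euclidean_space \<Rightarrow> ereal" and g :: "'a \<Rightarrow> 'a"
  assumes convex: "convex_ereal f"
    and closed: "closed (epi f)"
    and C1: "C1_with_gradient f g"
    and interior: "0 \<in> interior (eff_dom f)"
    and g_0 [simp]: "g 0 = 0"
    and f_0 [simp]: "f 0 = 0"
    and f_pos: "x \<noteq> 0 \<Longrightarrow> 0 < f x"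
begin

definition foot :: "'a \<Rightarrow> 'a" where
  "foot x = fst (closest_point (epi f) (x, 0))"

definition height :: "'a \<Rightarrow> real" where
  "height x = snd (closest_point (epi f) (x, 0))"

lemma closest_point_eq: "closest_point (epi f) (x, 0) = (foot x, height x)"
  by (simp add: foot_def height_def)

lemma f_nonneg: "0 \<le> f x"
  using f_pos[of x] by (cases "x = 0") auto

lemma f_real:
  assumes "x \<in> interior (eff_dom f)"
  shows "f x = ereal (real_of_ereal (f x))"
  using assms interior_subset[of "eff_dom f"] f_nonneg[of x]
  by (cases "f x") (auto simp: eff_dom_def)

lemma origin_in_epi: "(0, 0) \<in> epi f"
  by (simp add: epi_def)

lemma projection_normal:
  assumes "f u \<le> ereal s"
  shows "(x - foot x) \<bullet> (u - foot x) \<le> height x * (s - height x)"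
proof -
  have "(u, s) \<in> epi f" using assms by (simp add: epi_def)
  from closest_point_dot[OF convex_epi[OF convex] closed this, of "(x, 0)"]
  show ?thesis by (simp add: closest_point_eq inner_prod_def algebra_simps)
qed

lemma f_foot: "f (foot x) = ereal (height x)"
proof -
  have "(foot x, height x) \<in> epi f"
    using closest_point_in_set[OF closed] origin_in_epi closest_point_eq by (metis empty_iff)
  then have le: "f (foot x) \<le> ereal (height x)" by (simp add: epi_def)
  then obtain s where s: "f (foot x) = ereal s" "0 \<le> s" "s \<le> height x"
    using f_nonneg[of "foot x"] by (cases "f (foot x)") auto
  have "0 \<le> height x * (s - height x)"
    using projection_normal[of "foot x" s x] s by simp
  then have "s = height x"
    using s by (smt (verit) mult_pos_neg)
  then show ?thesis using s by simp
qed

lemma height_nonneg: "0 \<le> height x"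
  using f_nonneg[of "foot x"] by (simp add: f_foot)

lemma height_sq_le_inner: "(height x)\<^sup>2 \<le> (x - foot x) \<bullet> foot x"
  using projection_normal[of 0 0 x] by (simp add: power2_eq_square)

text \<open>A normal \<open>(v, -c)\<close> to the epigraph at a point over the interior of the domain: the function
  \<open>u \<mapsto> v \<bullet> u - c * f u\<close> is maximal at \<open>y\<close>, so its gradient \<open>v - c *\<^sub>R g y\<close> vanishes
  there.\<close>
lemma normal_eq_gradient:
  assumes y: "y \<in> interior (eff_dom f)"
    and normal: "\<And>u s. f u \<le> ereal s \<Longrightarrow> v \<bullet> (u - y) \<le> c * (s - real_of_ereal (f y))"
  shows "v = c *\<^sub>R g y"
proof -
  define F where "F = (\<lambda>u. real_of_ereal (f u))"
  define \<phi> where "\<phi> = (\<lambda>u. v \<bullet> u - c * F u)"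
  have "GDERIV F y :> g y"
    using C1 y unfolding C1_with_gradient_def F_def by blast
  then have "(F has_derivative (\<lambda>d. d \<bullet> g y)) (at y)"
    by (simp only: gderiv_def)
  then have d: "(\<phi> has_derivative (\<lambda>d. v \<bullet> d - c * (d \<bullet> g y))) (at y)"
    unfolding \<phi>_def by (auto intro!: derivative_eq_intros)
  have "\<forall>u\<in>interior (eff_dom f). \<phi> u \<le> \<phi> y"
  proof
    fix u assume "u \<in> interior (eff_dom f)"
    then have "v \<bullet> (u - y) \<le> c * (F u - F y)"
      using normal[of u "F u"] f_real[of u] by (simp add: F_def)
    then show "\<phi> u \<le> \<phi> y" by (simp add: \<phi>_def algebra_simps)
  qed
  then have "(\<lambda>d. v \<bullet> d - c * (d \<bullet> g y)) = (\<lambda>d. 0)"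
    using differential_zero_maxmin[OF y open_interior d] by blast
  then have "v \<bullet> d - c * (d \<bullet> g y) = 0" for d by metis
  from this[of "v - c *\<^sub>R g y"] have "(v - c *\<^sub>R g y) \<bullet> (v - c *\<^sub>R g y) = 0"
    by (simp add: algebra_simps inner_commute)
  then show ?thesis by simp
qed

lemma displacement_eq_gradient:
  assumes "foot x \<in> interior (eff_dom f)"
  shows "x - foot x = height x *\<^sub>R g (foot x)"
  using projection_normal[of _ _ x] by (intro normal_eq_gradient[OF assms]) (simp add: f_foot)

text \<open>The gradient inequality at \<open>y\<close>, tested at the minimizer: along the segment from \<open>y\<close> to
  \<open>0\<close> the convex function \<open>f\<close> stays below its chord, so its derivative at \<open>y\<close> in the
  direction \<open>-y\<close> is at most the slope \<open>-f y\<close> of that chord.\<close>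
lemma gradient_inequality:
  assumes y: "y \<in> interior (eff_dom f)"
  shows "real_of_ereal (f y) \<le> g y \<bullet> y"
proof (rule ccontr)
  assume neg: "\<not> ?thesis"
  define F where "F = (\<lambda>u. real_of_ereal (f u))"
  define \<phi> where "\<phi> = (\<lambda>t::real. (1 - t) * F y - F ((1 - t) *\<^sub>R y))"
  have "GDERIV F y :> g y"
    using C1 y unfolding C1_with_gradient_def F_def by blast
  then have F': "(F has_derivative (\<lambda>d. d \<bullet> g y)) (at ((1 - 0) *\<^sub>R y))"
    by (simp add: gderiv_def)
  have "((\<lambda>t::real. (1 - t) *\<^sub>R y) has_derivative (\<lambda>t. - t *\<^sub>R y)) (at 0)"
    by (auto intro!: derivative_eq_intros)
  from has_derivative_compose[OF this F']
  have "((\<lambda>t. F ((1 - t) *\<^sub>R y)) has_derivative (\<lambda>t. (- t *\<^sub>R y) \<bullet> g y)) (at 0)" .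
  then have "(\<phi> has_derivative (\<lambda>t. - t * F y - (- t *\<^sub>R y) \<bullet> g y)) (at 0)"
    unfolding \<phi>_def by (auto intro!: derivative_eq_intros)
  then have "(\<phi> has_real_derivative (g y \<bullet> y - F y)) (at 0)"
    unfolding has_field_derivative_def
    by (rule has_derivative_eq_rhs) (auto simp: algebra_simps inner_commute)
  moreover have "g y \<bullet> y - F y < 0" using neg by (simp add: F_def)
  ultimately obtain d where d: "d > 0" "\<And>t. 0 < t \<Longrightarrow> t < d \<Longrightarrow> \<phi> t < \<phi> 0"
    using DERIV_neg_dec_right[of \<phi> "g y \<bullet> y - F y" 0] by auto
  define t where "t = min (d / 2) (1 / 2)"
  have t: "0 < t" "t < 1" "t < d" using d(1) by (auto simp: t_def)
  have "f ((1 - t) *\<^sub>R y + t *\<^sub>R 0) \<le> ereal (1 - t) * f y + ereal t * f 0"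
    using convex t unfolding convex_ereal_def by blast
  moreover have "f y = ereal (F y)" unfolding F_def by (rule f_real[OF y])
  ultimately have "f ((1 - t) *\<^sub>R y) \<le> ereal ((1 - t) * F y)" by simp
  then have "F ((1 - t) *\<^sub>R y) \<le> (1 - t) * F y"
    using f_nonneg[of "(1 - t) *\<^sub>R y"] by (cases "f ((1 - t) *\<^sub>R y)") (auto simp: F_def)
  then have "0 \<le> \<phi> t" by (simp add: \<phi>_def)
  then show False using d(2)[OF t(1,3)] by (simp add: \<phi>_def)
qed

lemma f_le_norm_mult:
  assumes "y \<in> interior (eff_dom f)"
  shows "real_of_ereal (f y) \<le> norm y * norm (g y)"
  using gradient_inequality[OF assms] norm_cauchy_schwarz[of "g y" y] by (simp add: mult.commute)

lemma gradient_nonzero: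
  assumes "y \<in> interior (eff_dom f)" "y \<noteq> 0"
  shows "g y \<noteq> 0"
  using gradient_inequality[OF assms(1)] f_pos[OF assms(2)] f_real[OF assms(1)]
  by (cases "f y") auto

text \<open>At the origin the gradient is zero, so the normals to the epigraph are vertical there; hence a
  point \<open>(x, 0)\<close> with \<open>x \<noteq> 0\<close> is not projected to the origin.\<close>
lemma foot_nonzero:
  assumes "x \<noteq> 0"
  shows "foot x \<noteq> 0"
proof
  assume "foot x = 0"
  then show False
    using displacement_eq_gradient[of x] interior assms by simp
qed

lemma height_pos:
  assumes "x \<noteq> 0"
  shows "0 < height x"
  using f_pos[OF foot_nonzero[OF assms]] by (simp add: f_foot)

lemma foot_neq:
  assumes "x \<noteq> 0"
  shows "foot x \<noteq> x"
  using height_sq_le_inner[of x] height_pos[OF assms] by auto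

text \<open>Pythagoras as an inequality: the origin lies in the epigraph, so the triangle formed by the
  origin, \<open>(x, 0)\<close> and its projection has no acute angle at the projection.\<close>
lemma norm_foot_decrease:
  "(norm (foot x))\<^sup>2 + (infdist (x, 0) (epi f))\<^sup>2 \<le> (norm x)\<^sup>2"
proof -
  define v where "v = x - foot x"
  have "closest_point (epi f) (x, 0) \<in> epi f"
    using closest_point_in_set[OF closed] origin_in_epi by blast
  then have "infdist (x, 0) (epi f) \<le> dist (x, 0) (foot x, height x)"
    by (intro infdist_le) (simp add: closest_point_eq)
  then have "(infdist (x, 0) (epi f))\<^sup>2 \<le> (dist (x, 0) (foot x, height x))\<^sup>2"
    by (intro power_mono infdist_nonneg)
  also have "\<dots> = (norm v)\<^sup>2 + (height x)\<^sup>2"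
    by (simp add: dist_norm norm_prod_def v_def)
  finally have *: "(infdist (x, 0) (epi f))\<^sup>2 \<le> (norm v)\<^sup>2 + (height x)\<^sup>2" .
  have "(norm x)\<^sup>2 = (norm (foot x + v))\<^sup>2" by (simp add: v_def)
  also have "\<dots> = (norm (foot x))\<^sup>2 + 2 * (v \<bullet> foot x) + (norm v)\<^sup>2"
    by (simp add: power2_norm_eq_inner algebra_simps inner_commute)
  finally show ?thesis
    using * height_sq_le_inner[of x] zero_le_power2[of "height x"] unfolding v_def[symmetric] by linarith
qed

lemma norm_foot_le: "norm (foot x) \<le> norm x"
proof (rule power2_le_imp_le)
  show "(norm (foot x))\<^sup>2 \<le> (norm x)\<^sup>2"
    using norm_foot_decrease[of x] zero_le_power2[of "infdist (x, 0) (epi f)"] by linarith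
qed simp

text \<open>Both methods satisfy the hypothesis. The squared norms decrease to a limit, so the distances
  to the epigraph, which the decrements dominate, tend to \<open>0\<close>; a cluster point therefore lies in
  the epigraph and in the horizontal subspace, hence is the origin.\<close>
lemma tendsto_zero_of_norm_le_foot:
  assumes step: "\<And>k. norm (X (Suc k)) \<le> norm (foot (X k))"
  shows "X \<longlonglongrightarrow> 0"
proof -
  define D where "D = (\<lambda>x. infdist (x, 0) (epi f))"
  define N where "N = (\<lambda>k. (norm (X k))\<^sup>2)"
  have decr: "N (Suc k) + (D (X k))\<^sup>2 \<le> N k" for k
  proof -
    have "N (Suc k) \<le> (norm (foot (X k)))\<^sup>2"
      unfolding N_def by (intro power_mono step norm_ge_zero)
    then show ?thesis
      using norm_foot_decrease[of "X k"] unfolding D_def N_def by linarith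
  qed
  have dec: "decseq N"
  proof (rule decseq_SucI)
    show "N (Suc k) \<le> N k" for k
      using decr[of k] zero_le_power2[of "D (X k)"] by linarith
  qed
  then obtain L where L: "N \<longlonglongrightarrow> L"
    using decseq_convergent[of N 0] by (auto simp: N_def)
  have "(\<lambda>k. N k - N (Suc k)) \<longlonglongrightarrow> L - L"
    by (intro tendsto_diff L LIMSEQ_Suc)
  then have diff: "(\<lambda>k. N k - N (Suc k)) \<longlonglongrightarrow> 0" by simp
  have le: "\<forall>\<^sub>F k in sequentially. (D (X k))\<^sup>2 \<le> N k - N (Suc k)"
    using decr by (intro always_eventually) (simp add: le_diff_eq add.commute)
  have "(\<lambda>k. (D (X k))\<^sup>2) \<longlonglongrightarrow> 0"
    by (rule tendsto_sandwich[OF _ le tendsto_const diff]) simp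
  then have "(\<lambda>k. sqrt ((D (X k))\<^sup>2)) \<longlonglongrightarrow> sqrt 0"
    by (rule tendsto_real_sqrt)
  then have D0: "(\<lambda>k. D (X k)) \<longlonglongrightarrow> 0"
    by (simp add: D_def infdist_nonneg)
  have "X k \<in> cball 0 (norm (X 0))" for k
    using decseqD[OF dec, of 0 k] by (simp add: N_def)
  then obtain l r where r: "strict_mono r" and l: "(X \<circ> r) \<longlonglongrightarrow> l"
    using compact_cball[of 0 "norm (X 0)"] unfolding compact_def by metis
  have "(\<lambda>k. D ((X \<circ> r) k)) \<longlonglongrightarrow> D l"
    unfolding D_def by (intro tendsto_intros l)
  moreover have "(\<lambda>k. D ((X \<circ> r) k)) \<longlonglongrightarrow> 0"
    using LIMSEQ_subseq_LIMSEQ[OF D0 r] by (simp add: o_def)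
  ultimately have "D l = 0" by (rule LIMSEQ_unique)
  then have "(l, 0) \<in> epi f"
    using in_closed_iff_infdist_zero[OF closed] origin_in_epi by (auto simp: D_def)
  then have "l = 0"
    using f_pos[of l] unfolding epi_def by (auto simp: zero_ereal_def leD)
  \<comment> \<open>The norms decrease, so the limit along the subsequence is the limit of the whole sequence.\<close>
  have "(\<lambda>k. (norm ((X \<circ> r) k))\<^sup>2) \<longlonglongrightarrow> (norm l)\<^sup>2"
    by (intro tendsto_intros l)
  moreover have "(\<lambda>k. (norm ((X \<circ> r) k))\<^sup>2) \<longlonglongrightarrow> L"
    using LIMSEQ_subseq_LIMSEQ[OF L r] by (simp add: o_def N_def)
  ultimately have "(norm l)\<^sup>2 = L" by (rule LIMSEQ_unique)
  then have "L = 0" using \<open>l = 0\<close> by simp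
  with L have "(\<lambda>k. sqrt (N k)) \<longlonglongrightarrow> sqrt 0" by (intro tendsto_real_sqrt) simp
  then show ?thesis by (simp add: N_def tendsto_norm_zero_iff)
qed

lemma foot_tendsto_zero:
  assumes "X \<longlonglongrightarrow> 0"
  shows "(\<lambda>k. foot (X k)) \<longlonglongrightarrow> 0"
    and "\<forall>\<^sub>F k in sequentially. foot (X k) \<in> interior (eff_dom f)"
proof -
  show lim: "(\<lambda>k. foot (X k)) \<longlonglongrightarrow> 0"
    using tendsto_norm_zero[OF assms] norm_foot_le
    by (intro Lim_null_comparison[OF _ tendsto_norm_zero[OF assms]]) simp
  show "\<forall>\<^sub>F k in sequentially. foot (X k) \<in> interior (eff_dom f)"
    using topological_tendstoD[OF lim open_interior interior] .
qed

section \<open>The rate of alternating projections\<close>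

lemma norm_le_foot:
  assumes y: "foot x \<in> interior (eff_dom f)"
  shows "norm x \<le> norm (foot x) * (1 + (norm (g (foot x)))\<^sup>2)"
proof -
  have "norm x \<le> norm (foot x) + norm (x - foot x)"
    using norm_triangle_ineq[of "foot x" "x - foot x"] by simp
  also have "norm (x - foot x) = height x * norm (g (foot x))"
    using displacement_eq_gradient[OF y] height_nonneg[of x] by simp
  also have "\<dots> \<le> (norm (foot x) * norm (g (foot x))) * norm (g (foot x))"
    using f_le_norm_mult[OF y] by (intro mult_right_mono) (auto simp: f_foot)
  finally show ?thesis by (simp add: algebra_simps power2_eq_square)
qed

lemma foot_iterates_rate:
  assumes X: "X \<longlonglongrightarrow> 0" and nz: "\<And>k. X k \<noteq> 0"
  shows "1 \<le> limsup (\<lambda>k. ereal (norm (foot (X k)) / norm (X k)))"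
proof -
  note lim = foot_tendsto_zero(1)[OF X]
  have "isCont g 0"
    using C1 interior by (simp add: C1_with_gradient_def continuous_on_eq_continuous_at)
  then have "(\<lambda>k. g (foot (X k))) \<longlonglongrightarrow> g 0"
    using lim by (rule isCont_tendsto_compose)
  then have "(\<lambda>k. 1 / (1 + (norm (g (foot (X k))))\<^sup>2)) \<longlonglongrightarrow> 1 / (1 + (norm (g 0))\<^sup>2)"
    by (intro tendsto_intros) auto
  then have "(\<lambda>k. ereal (1 / (1 + (norm (g (foot (X k))))\<^sup>2))) \<longlonglongrightarrow> ereal 1"
    by simp
  then have "limsup (\<lambda>k. ereal (1 / (1 + (norm (g (foot (X k))))\<^sup>2))) = ereal 1"
    by (intro lim_imp_Limsup) auto
  moreover have le: "\<forall>\<^sub>F k in sequentially.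
      ereal (1 / (1 + (norm (g (foot (X k))))\<^sup>2)) \<le> ereal (norm (foot (X k)) / norm (X k))"
    using foot_tendsto_zero(2)[OF X]
  proof eventually_elim
    case (elim k)
    have "0 < 1 + (norm (g (foot (X k))))\<^sup>2" by (smt (verit) zero_le_power2)
    then show ?case
      using norm_le_foot[OF elim] nz[of k] by (simp add: field_simps)
  qed
  ultimately show ?thesis
    using Limsup_mono[OF le] by (simp add: one_ereal_def)
qed

section \<open>The rate of the circumcentered-reflection method\<close>

text \<open>The point where the line through \<open>x\<close> and \<open>foot x\<close> meets the supporting hyperplane of the
  epigraph at \<open>(foot x, height x)\<close>; \<open>CRM_op_horizontal\<close> identifies it with the
  circumcenter.\<close>
definition crm_step :: "'a \<Rightarrow> 'a" where
  "crm_step x = foot x - ((height x)\<^sup>2 / (norm (x - foot x))\<^sup>2) *\<^sub>R (x - foot x)"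

text \<open>Subtracting the multiple of \<open>x - foot x\<close> shortens \<open>foot x\<close> because these two vectors have
  inner product at least \<open>(height x)\<^sup>2\<close>, which is the length of the step times the norm of
  \<open>x - foot x\<close>.\<close>
lemma norm_crm_step:
  "(norm (crm_step x))\<^sup>2 + ((height x)\<^sup>2 / norm (x - foot x))\<^sup>2 \<le> (norm (foot x))\<^sup>2"
proof (cases "x = foot x")
  case True
  then show ?thesis by (simp add: crm_step_def)
next
  case False
  define v where "v = x - foot x"
  define m where "m = (height x)\<^sup>2 / (norm v)\<^sup>2"
  have m: "m * (norm v)\<^sup>2 = (height x)\<^sup>2" "0 \<le> m" using False by (auto simp: m_def v_def)
  have "(norm (crm_step x))\<^sup>2 = (norm (foot x))\<^sup>2 - 2 * m * (v \<bullet> foot x) + m\<^sup>2 * (norm v)\<^sup>2"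
    unfolding crm_step_def v_def[symmetric] m_def[symmetric]
    unfolding power2_norm_eq_inner
    by (simp add: algebra_simps inner_commute power2_eq_square)
  also have "\<dots> \<le> (norm (foot x))\<^sup>2 - 2 * m * (m * (norm v)\<^sup>2) + m\<^sup>2 * (norm v)\<^sup>2"
    using mult_left_mono[OF height_sq_le_inner[of x], of "2 * m"] m by (simp add: v_def[symmetric])
  also have "\<dots> = (norm (foot x))\<^sup>2 - (m * norm v)\<^sup>2"
    by (simp add: power2_eq_square algebra_simps)
  also have "m * norm v = (height x)\<^sup>2 / norm v"
    by (simp add: m_def power2_eq_square)
  finally show ?thesis by (simp add: v_def)
qed

lemma norm_crm_step_le_foot: "norm (crm_step x) \<le> norm (foot x)"
proof (rule power2_le_imp_le)
  show "(norm (crm_step x))\<^sup>2 \<le> (norm (foot x))\<^sup>2"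
    using norm_crm_step[of x] zero_le_power2[of "(height x)\<^sup>2 / norm (x - foot x)"] by linarith
qed simp

text \<open>If the step reached the origin, the supporting hyperplane at the projected point would pass
  through the origin and support the epigraph there as well; as normals at the origin are vertical,
  the displacement \<open>x - foot x\<close> would vanish.\<close>
lemma crm_step_nonzero:
  assumes x: "x \<noteq> 0"
  shows "crm_step x \<noteq> 0"
proof
  assume 0: "crm_step x = 0"
  define v where "v = x - foot x"
  have v: "v \<noteq> 0" using foot_neq[OF x] by (simp add: v_def)
  have "foot x = ((height x)\<^sup>2 / (norm v)\<^sup>2) *\<^sub>R v"
    using 0 by (simp add: crm_step_def v_def)
  then have vy: "v \<bullet> foot x = (height x)\<^sup>2"
    using v by (simp add: power2_norm_eq_inner)
  have "v \<bullet> (u - 0) \<le> height x * (s - real_of_ereal (f 0))" if "f u \<le> ereal s" for u s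
    using projection_normal[OF that, of x] vy
    by (simp add: v_def[symmetric] inner_diff_right power2_eq_square algebra_simps)
  then have "v = height x *\<^sub>R g 0"
    by (rule normal_eq_gradient[OF interior])
  then show False using v by simp
qed

lemma crm_step_ratio:
  assumes x: "x \<noteq> 0" and y: "foot x \<in> interior (eff_dom f)"
    and c: "0 \<le> c" "c \<le> real_of_ereal (f (foot x)) / (norm (foot x) * norm (g (foot x)))"
  shows "norm (crm_step x) / norm x \<le> sqrt (1 - c\<^sup>2)"
proof -
  define h n G where "h = height x" and "n = norm (foot x)" and "G = norm (g (foot x))"
  have pos: "0 < h" "0 < n" "0 < G"
    using height_pos[OF x] foot_nonzero[OF x] gradient_nonzero[OF y] by (auto simp: h_def n_def G_def)
  have "c * n \<le> h / G"
    using c(2) pos unfolding f_foot n_def[symmetric] G_def[symmetric] h_def[symmetric]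
    by (simp add: field_simps)
  then have "(c * n)\<^sup>2 \<le> (h / G)\<^sup>2" using c pos by (intro power_mono) auto
  moreover have "(height x)\<^sup>2 / norm (x - foot x) = h / G"
    using pos displacement_eq_gradient[OF y] by (simp add: h_def G_def power2_eq_square)
  ultimately have "(norm (crm_step x))\<^sup>2 \<le> (1 - c\<^sup>2) * n\<^sup>2"
    using norm_crm_step[of x] by (simp add: n_def power_mult_distrib algebra_simps)
  then have "sqrt ((norm (crm_step x))\<^sup>2) \<le> sqrt ((1 - c\<^sup>2) * n\<^sup>2)"
    by (rule real_sqrt_le_mono)
  then have *: "norm (crm_step x) \<le> sqrt (1 - c\<^sup>2) * n"
    using pos by (simp add: real_sqrt_mult)
  then have "0 \<le> sqrt (1 - c\<^sup>2)"
    using pos by (smt (verit) mult_neg_pos norm_ge_zero)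
  then have "sqrt (1 - c\<^sup>2) * n \<le> sqrt (1 - c\<^sup>2) * norm x"
    using norm_foot_le[of x] by (intro mult_left_mono) (auto simp: n_def)
  then show ?thesis using * x by (simp add: field_simps)
qed

definition slope_ratio :: ereal where
  "slope_ratio = Liminf (at 0) (\<lambda>x. f x / ereal (norm x * norm (g x)))"

lemma quotient_real:
  assumes "x \<in> interior (eff_dom f)" "x \<noteq> 0"
  shows "f x / ereal (norm x * norm (g x)) = ereal (real_of_ereal (f x) / (norm x * norm (g x)))"
  using f_real[OF assms(1)] gradient_nonzero[OF assms] assms(2)
  by (metis ereal_divide mult_eq_0_iff norm_eq_zero)

lemma slope_ratio_le_1: "slope_ratio \<le> 1"
proof (rule ccontr)
  assume "\<not> ?thesis"
  then have "\<forall>\<^sub>F x in at 0. 1 < f x / ereal (norm x * norm (g x))"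
    unfolding slope_ratio_def by (intro less_LiminfD) simp
  moreover have "\<forall>\<^sub>F x in at 0. x \<in> interior (eff_dom f) \<and> x \<noteq> 0"
    using interior by (auto simp: eventually_at_topological)
  ultimately have "\<forall>\<^sub>F x::'a in at 0. False"
  proof eventually_elim
    case (elim x)
    then have "1 < real_of_ereal (f x) / (norm x * norm (g x))"
      by (simp add: quotient_real one_ereal_def)
    moreover have "0 < norm x * norm (g x)" using elim gradient_nonzero by auto
    ultimately show ?case using f_le_norm_mult[of x] elim by (simp add: field_simps)
  qed
  then show False by simp
qed

lemma crm_rate:
  assumes X: "X \<longlonglongrightarrow> 0" and nz: "\<And>k. X k \<noteq> 0" and pos: "0 < slope_ratio"
  shows "limsup (\<lambda>k. ereal (norm (crm_step (X k)) / norm (X k)))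
    \<le> ereal (sqrt (1 - (real_of_ereal slope_ratio)\<^sup>2))" (is "?L \<le> _")
proof -
  obtain \<gamma> where \<gamma>: "slope_ratio = ereal \<gamma>" "0 < \<gamma>"
    using slope_ratio_le_1 pos by (cases slope_ratio) auto
  \<comment> \<open>The quotient is only known to exceed constants below its lower limit, so the bound is proved
    for each of them and passed to the limit from the left.\<close>
  have bound: "?L \<le> ereal (sqrt (1 - c\<^sup>2))" if c: "0 < c" "c < \<gamma>" for c
  proof (rule Limsup_bounded)
    have "\<forall>\<^sub>F x in at 0. ereal c < f x / ereal (norm x * norm (g x))"
      using c \<gamma> unfolding slope_ratio_def by (intro less_LiminfD) simp
    moreover have "filterlim (\<lambda>k. foot (X k)) (at 0) sequentially"
      using foot_tendsto_zero(1)[OF X] foot_nonzero nz by (simp add: filterlim_at)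
    ultimately have "\<forall>\<^sub>F k in sequentially.
        ereal c < f (foot (X k)) / ereal (norm (foot (X k)) * norm (g (foot (X k))))"
      by (rule eventually_compose_filterlim)
    with foot_tendsto_zero(2)[OF X]
    show "\<forall>\<^sub>F k in sequentially.
        ereal (norm (crm_step (X k)) / norm (X k)) \<le> ereal (sqrt (1 - c\<^sup>2))"
    proof eventually_elim
      case (elim k)
      then show ?case
        using crm_step_ratio[OF nz[of k] elim(1), of c] c foot_nonzero[OF nz[of k]]
        by (simp add: quotient_real)
    qed
  qed
  have "((\<lambda>c. ereal (sqrt (1 - c\<^sup>2))) \<longlongrightarrow> ereal (sqrt (1 - \<gamma>\<^sup>2))) (at_left \<gamma>)"
    by (intro tendsto_intros)
  moreover have "\<forall>\<^sub>F c in at_left \<gamma>. ?L \<le> ereal (sqrt (1 - c\<^sup>2))"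
    using eventually_at_left[OF \<gamma>(2)] bound \<gamma>(2) by auto
  ultimately have "?L \<le> ereal (sqrt (1 - \<gamma>\<^sup>2))"
    by (rule tendsto_lowerbound) simp
  then show ?thesis by (simp add: \<gamma>)
qed

end

section \<open>The two operators on the horizontal subspace\<close>

lemma closest_point_horizontal:
  fixes y :: "'a::euclidean_space"
  shows "closest_point {(x, 0::real) | x. True} (y, t) = (y, 0)"
proof -
  have U: "{(x::'a, 0::real) | x. True} = UNIV \<times> {0}" by auto
  have "convex (UNIV \<times> {0} :: ('a \<times> real) set)" by (intro convex_Times) auto
  moreover have "closed (UNIV \<times> {0} :: ('a \<times> real) set)" by (intro closed_Times) auto
  moreover have "\<forall>z\<in>UNIV \<times> {0}. dist (y, t) (y, 0) \<le> dist (y, t) z"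
    by (auto simp: dist_Pair_Pair)
  ultimately show ?thesis
    unfolding U by (intro closest_point_unique[symmetric]) auto
qed

text \<open>The points \<open>(x - 2 *\<^sub>R v, 2 * h)\<close> and \<open>(x - 2 *\<^sub>R v, - 2 * h)\<close> are mirror images in the
  horizontal subspace, so a point of the affine hull equidistant from them is horizontal; it then lies
  on the line through \<open>x\<close> in the direction \<open>v\<close>, where equidistance from \<open>(x, 0)\<close> is a linear
  equation.\<close>
lemma circ_isosceles:
  fixes x v :: "'a::euclidean_space" and h :: real
  assumes v: "v \<noteq> 0" and h: "h \<noteq> 0"
  shows "circ (x, 0) (x - 2 *\<^sub>R v, 2 * h) (x - 2 *\<^sub>R v, - 2 * h)
    = (x - (1 + h\<^sup>2 / (norm v)\<^sup>2) *\<^sub>R v, 0)" (is "circ ?a ?b ?c = ?p")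
proof -
  define m where "m = h\<^sup>2 / (norm v)\<^sup>2"
  have mv: "m * (v \<bullet> v) = h\<^sup>2" using v by (simp add: m_def power2_norm_eq_inner)
  have vv: "0 < v \<bullet> v" using v by simp
  have dist_sq: "dist p q = dist p r \<longleftrightarrow> (p - q) \<bullet> (p - q) = (p - r) \<bullet> (p - r)"
    for p q r :: "'a \<times> real"
    by (simp add: dist_norm norm_eq_sqrt_inner)
  show ?thesis
    unfolding circ_def m_def[symmetric]
  proof (rule the_equality, intro conjI)
    have "(x - (1 + m) *\<^sub>R v, 0)
        = (1 - (1 + m) / 2) *\<^sub>R ?a + ((1 + m) / 4) *\<^sub>R ?b + ((1 + m) / 4) *\<^sub>R ?c"
      by (simp add: algebra_simps flip: scaleR_add_left) (simp add: field_simps)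
    moreover have "(1 - (1 + m) / 2) + (1 + m) / 4 + (1 + m) / 4 = 1"
      by (simp add: field_simps)
    ultimately show "(x - (1 + m) *\<^sub>R v, 0) \<in> affine hull {?a, ?b, ?c}"
      unfolding affine_hull_3 by blast
    have d: "(x - (1 + m) *\<^sub>R v) - (x - 2 *\<^sub>R v) = (1 - m) *\<^sub>R v"
      by (simp add: algebra_simps scaleR_2)
    show "dist (x - (1 + m) *\<^sub>R v, 0) ?a = dist (x - (1 + m) *\<^sub>R v, 0) ?b"
      and "dist (x - (1 + m) *\<^sub>R v, 0) ?a = dist (x - (1 + m) *\<^sub>R v, 0) ?c"
      unfolding dist_sq diff_Pair d using mv
      by (auto simp: inner_prod_def power2_eq_square algebra_simps)
  next
    fix p assume "p \<in> affine hull {?a, ?b, ?c} \<and> dist p ?a = dist p ?b \<and> dist p ?a = dist p ?c"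
    then obtain u s t where ust: "u + s + t = 1" and p: "p = u *\<^sub>R ?a + s *\<^sub>R ?b + t *\<^sub>R ?c"
      and ab: "dist p ?a = dist p ?b" and ac: "dist p ?a = dist p ?c"
      unfolding affine_hull_3 by blast
    have u: "u = 1 - s - t" using ust by simp
    have p': "p = (x - (2 * (s + t)) *\<^sub>R v, 2 * h * (s - t))"
      unfolding p u by (simp add: algebra_simps flip: scaleR_add_left)
    have d: "(x - (2 * (s + t)) *\<^sub>R v) - (x - 2 *\<^sub>R v) = (2 - 2 * (s + t)) *\<^sub>R v"
      by (simp add: algebra_simps)
    have "(p - ?b) \<bullet> (p - ?b) = (p - ?c) \<bullet> (p - ?c)"
      using ab ac by (simp add: dist_sq[symmetric])
    then have "h * h * (s - t) = 0"
      unfolding p' diff_Pair d by (auto simp: inner_prod_def algebra_simps)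
    then have st: "s = t" using h by auto
    have "(p - ?a) \<bullet> (p - ?a) = (p - ?b) \<bullet> (p - ?b)"
      using ab by (simp add: dist_sq)
    then have "4 * s * (v \<bullet> v) = v \<bullet> v + h\<^sup>2"
      unfolding p' diff_Pair d st by (simp add: inner_prod_def power2_eq_square algebra_simps)
    then have "4 * s * (v \<bullet> v) = (1 + m) * (v \<bullet> v)" using mv by (simp add: algebra_simps)
    then have "4 * s = 1 + m" using vv by simp
    then show "p = (x - (1 + m) *\<^sub>R v, 0)" unfolding p' st by (simp add: algebra_simps)
  qed
qed

lemma funpow_horizontal:
  fixes A :: "'a::zero \<times> real \<Rightarrow> 'a \<times> real" and S :: "'a \<Rightarrow> 'a"
  assumes "\<And>x. x \<noteq> 0 \<Longrightarrow> A (x, 0) = (S x, 0)" and "\<And>x. x \<noteq> 0 \<Longrightarrow> S x \<noteq> 0" and "x \<noteq> 0"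
  shows "(A ^^ k) (x, 0) = ((S ^^ k) x, 0) \<and> (S ^^ k) x \<noteq> 0"
  using assms by (induction k) auto

context epigraph_minimum
begin

lemma MAP_op_horizontal: "MAP_op (epi f) {(x, 0) | x. True} (x, 0) = (foot x, 0)"
  by (simp add: MAP_op_def closest_point_eq closest_point_horizontal[simplified])

lemma CRM_op_horizontal:
  assumes x: "x \<noteq> 0"
  shows "CRM_op (epi f) {(x, 0) | x. True} (x, 0) = (crm_step x, 0)"
proof -
  define v where "v = x - foot x"
  have "reflection (epi f) (x, 0) = (x - 2 *\<^sub>R v, 2 * height x)"
    by (simp add: reflection_def closest_point_eq v_def algebra_simps scaleR_2)
  moreover have "reflection {(x, 0) | x. True} (x - 2 *\<^sub>R v, 2 * height x)
      = (x - 2 *\<^sub>R v, - 2 * height x)"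
    by (simp add: reflection_def closest_point_horizontal[simplified] scaleR_2)
  ultimately have "CRM_op (epi f) {(x, 0) | x. True} (x, 0)
      = (x - (1 + (height x)\<^sup>2 / (norm v)\<^sup>2) *\<^sub>R v, 0)"
    using circ_isosceles[of v "height x" x] foot_neq[OF x] height_pos[OF x]
    by (simp add: CRM_op_def v_def)
  then show ?thesis by (simp add: crm_step_def v_def algebra_simps)
qed

text \<open>After one step an arbitrary starting point has been moved into the horizontal subspace, and
  dropping that step changes neither convergence nor the asymptotic constant.\<close>
lemma MAP_sublinear:
  assumes z: "MAP_op (epi f) {(x, 0) | x. True} z \<noteq> 0"
  shows "Q_sublinear (\<lambda>k. (MAP_op (epi f) {(x, 0) | x. True} ^^ k) z) 0"
proof -
  let ?T = "MAP_op (epi f) {(x, 0) | x. True}"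
  define W where "W = (\<lambda>k. (?T ^^ k) z)"
  define X where "X = (\<lambda>k. (foot ^^ k) (fst (?T z)))"
  obtain y where y: "?T z = (y, 0)"
    by (cases "closest_point (epi f) z") (auto simp: MAP_op_def closest_point_horizontal[simplified])
  then have "y \<noteq> 0" using z by (auto simp: zero_prod_def)
  have iter: "(?T ^^ k) (y, 0) = (X k, 0) \<and> X k \<noteq> 0" for k
    unfolding X_def y fst_conv
    by (intro funpow_horizontal MAP_op_horizontal foot_nonzero \<open>y \<noteq> 0\<close>)
  then have nz: "X k \<noteq> 0" for k by blast
  have W: "W (Suc k) = (X k, 0)" for k
    unfolding W_def using iter[of k] by (simp only: funpow_Suc_right o_apply y)
  have X_Suc: "X (Suc k) = foot (X k)" for k by (simp add: X_def)
  have lim: "X \<longlonglongrightarrow> 0"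
    by (intro tendsto_zero_of_norm_le_foot) (simp add: X_Suc)
  have "(\<lambda>k. W (Suc k)) \<longlonglongrightarrow> (0, 0)"
    unfolding W by (intro tendsto_intros lim)
  then have W_lim: "W \<longlonglongrightarrow> 0"
    unfolding zero_prod_def by (subst (asm) filterlim_sequentially_Suc)
  have "?T 0 = 0"
    using closest_point_self[OF origin_in_epi]
    by (simp add: MAP_op_def zero_prod_def closest_point_horizontal[simplified])
  then have "W k \<noteq> 0" for k
    using z nz W by (cases k) (auto simp: W_def zero_prod_def)
  moreover have "asymptotic_constant W 0 = limsup (\<lambda>k. ereal (norm (foot (X k)) / norm (X k)))"
    unfolding asymptotic_constant_def
    by (subst limsup_shift[symmetric]) (simp add: W X_Suc norm_prod_def)
  ultimately show ?thesis
    using foot_iterates_rate[OF lim nz] W_lim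
    by (simp add: Q_sublinear_def has_Q_rate_def W_def)
qed

lemma CRM_rate:
  assumes x: "x \<noteq> 0" and pos: "0 < slope_ratio"
  defines "W \<equiv> \<lambda>k. (CRM_op (epi f) {(x, 0) | x. True} ^^ k) (x, 0)"
  shows "has_Q_rate W 0"
    and "asymptotic_constant W 0 \<le> ereal (sqrt (1 - (real_of_ereal slope_ratio)\<^sup>2))"
proof -
  define X where "X = (\<lambda>k. (crm_step ^^ k) x)"
  have "W k = (X k, 0) \<and> X k \<noteq> 0" for k
    unfolding W_def X_def by (intro funpow_horizontal CRM_op_horizontal crm_step_nonzero x)
  then have W: "W k = (X k, 0)" and nz: "X k \<noteq> 0" for k by auto
  have X_Suc: "X (Suc k) = crm_step (X k)" for k by (simp add: X_def)
  have lim: "X \<longlonglongrightarrow> 0"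
    by (intro tendsto_zero_of_norm_le_foot) (simp add: X_Suc norm_crm_step_le_foot)
  have "(\<lambda>k. (X k, 0::real)) \<longlonglongrightarrow> (0, 0)"
    by (intro tendsto_intros lim)
  then show "has_Q_rate W 0"
    unfolding has_Q_rate_def W using nz by (simp add: zero_prod_def)
  show "asymptotic_constant W 0 \<le> ereal (sqrt (1 - (real_of_ereal slope_ratio)\<^sup>2))"
    using crm_rate[OF lim nz pos]
    by (simp add: asymptotic_constant_def W X_Suc norm_prod_def)
qed

end

lemma asymptotic_constant_nonneg: "0 \<le> asymptotic_constant y l"
  unfolding asymptotic_constant_def
  by (intro le_Limsup) (auto intro!: always_eventually)

section \<open>The rates of the two methods\<close>

theorem corollary4p4:
  fixes f :: "real ^ 'n \<Rightarrow> ereal"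
    and g :: "real ^ 'n \<Rightarrow> real ^ 'n"
    and K U :: "((real ^ 'n) \<times> real) set"
    and \<gamma> :: ereal
  assumes "proper_ereal f"
    and "convex_ereal f"
    and "closed (epi f)"
    and "C1_with_gradient f g"
    and "0 \<in> interior (eff_dom f)"
    and "\<forall>x. is_arg_min f (\<lambda>_. True) x \<longleftrightarrow> x = 0"
    and "g 0 = 0"
    and "f 0 = 0"
    and "K = epi f"
    and "U = {(x, 0) | x. True}"
    and "\<gamma> = Liminf (at 0) (\<lambda>x. f x / ereal (norm x * norm (g x)))"
  shows "(\<forall>z. MAP_op K U z \<noteq> 0 \<longrightarrow> Q_sublinear (\<lambda>k. (MAP_op K U ^^ k) z) 0) \<and>
         (\<gamma> > 0 \<longrightarrow>
            sqrt (1 - (real_of_ereal \<gamma>)\<^sup>2) < 1 \<and>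
            (\<forall>w\<in>U. w \<noteq> 0 \<longrightarrow>
               (Q_linear (\<lambda>k. (CRM_op K U ^^ k) w) 0 \<or> Q_superlinear (\<lambda>k. (CRM_op K U ^^ k) w) 0) \<and>
               asymptotic_constant (\<lambda>k. (CRM_op K U ^^ k) w) 0
                 \<le> ereal (sqrt (1 - (real_of_ereal \<gamma>)\<^sup>2))))"
proof -
  have f_pos: "0 < f x" if "x \<noteq> 0" for x
  proof -
    have min: "0 \<le> f y" for y
      using assms(6)[rule_format, of 0] \<open>f 0 = 0\<close> by (auto simp: is_arg_min_def not_less)
    moreover have "f x \<noteq> 0"
    proof
      assume "f x = 0"
      then have "is_arg_min f (\<lambda>_. True) x" using min by (simp add: is_arg_min_def not_less)
      then show False using assms(6) that by blast
    qed
    ultimately show ?thesis by (simp add: order_less_le)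
  qed
  interpret epigraph_minimum f g
    using assms f_pos by unfold_locales auto
  have \<gamma>: "\<gamma> = slope_ratio" using assms by (simp add: slope_ratio_def)
  have K: "K = epi f" and U: "U = {(x, 0) | x. True}" by fact+
  show ?thesis
  proof (intro conjI allI impI ballI)
    fix z assume "MAP_op K U z \<noteq> 0"
    then show "Q_sublinear (\<lambda>k. (MAP_op K U ^^ k) z) 0"
      unfolding K U by (rule MAP_sublinear)
  next
    assume pos: "0 < \<gamma>"
    then have "0 < real_of_ereal \<gamma>"
      using slope_ratio_le_1 unfolding \<gamma> by (cases slope_ratio) auto
    then show less_1: "sqrt (1 - (real_of_ereal \<gamma>)\<^sup>2) < 1" by simp
    fix w assume "w \<in> U" "w \<noteq> 0"
    then obtain x where w: "w = (x, 0)" "x \<noteq> 0" by (auto simp: U zero_prod_def)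
    let ?W = "\<lambda>k. (CRM_op K U ^^ k) w"
    have rate: "has_Q_rate ?W 0"
      and bound: "asymptotic_constant ?W 0 \<le> ereal (sqrt (1 - (real_of_ereal \<gamma>)\<^sup>2))"
      using CRM_rate[OF w(2)] pos by (simp_all add: \<gamma> K U w(1))
    show "asymptotic_constant ?W 0 \<le> ereal (sqrt (1 - (real_of_ereal \<gamma>)\<^sup>2))" by fact
    have "asymptotic_constant ?W 0 < 1"
      using bound less_1 by (metis ereal_less(3) le_less_trans)
    then show "Q_linear ?W 0 \<or> Q_superlinear ?W 0"
      using rate asymptotic_constant_nonneg[of ?W 0]
      by (auto simp: Q_linear_def Q_superlinear_def order_less_le)
  qed
qed

end
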